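(* Let $G=(V,E)$ be a connected graph on $n$ vertices, and let $W\subseteq V$ admit a partition $W=Q\sqcup S_1\sqcup S_2\sqcup P$ with the following structural conditions: (i) every node in $Q$ has all its neighbors inside $S_1$, i.e. $N(i)\subseteq S_1$ for all $i\in Q$; (ii) for each $i\in S_1\sqcup S_2$, its neighborhood decomposes as $N(i)=P\sqcup N_Q(i)\sqcup\bigl((S_1\sqcup S_2)\setminus\{i\}\bigr)$, where $N_Q(i)=\{q\in Q: q\sim i\}$. Assume further that $\{\boldsymbol v_i\}_{i\in V}$ corresponds to a second-order stationary point $\boldsymbol\theta\in\mathbb{R}^n$ of the Kuramoto energy $E_G$ at which the induced subgraph on $Q\sqcup S_1$ is synchronized, i.e. $\boldsymbol v_i=\boldsymbol v$ for all $i\in Q\sqcup S_1$, for some common phasor $\boldsymbol v$. Then the set $S_1\sqcup S_2$ synchronizes, i.e. $\boldsymbol v_i=\boldsymbol v_j$ for all $i,j\in S_1\sqcup S_2$.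
   Context: Graphs are finite and simple. $G=(V,E)$ has vertex set $V=\{1,\dots,n\}$ and adjacency matrix $A$. $u\sim v$ means $u$ and $v$ are adjacent; $N(i)$ is the set of all neighbors of $i$ in $G$; $\sqcup$ denotes disjoint union. The Kuramoto energy is $E_G(\boldsymbol\theta)=\frac12\sum_{1\le i,j\le n}A_{ij}\bigl(1-\cos(\theta_i-\theta_j)\bigr)$ for $\boldsymbol\theta\in\mathbb{R}^n$. A second-order stationary point of $E_G$ is a $\boldsymbol\theta\in\mathbb{R}^n$ with $\nabla E_G(\boldsymbol\theta)=0$ and $\nabla^2E_G(\boldsymbol\theta)$ positive semidefinite. The phasor of node $i$ is $\boldsymbol v_i=(\cos\theta_i,\sin\theta_i)\in\mathbb{R}^2$; a phasor is a unit vector in $\mathbb{R}^2$. *)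

theory Defs
  imports "HOL-Analysis.Analysis" "Graph_Theory.Digraph_Component"
begin

text \<open>
  A finite simple graph on \<open>n\<close> labelled vertices is a \<^locale>\<open>pair_graph\<close> (finite, loop-free,
  symmetric arc set) whose vertex set is the whole of a finite index type \<open>'n\<close>; thus
  \<open>n = CARD('n)\<close>, and angle vectors \<open>\<theta> \<in> \<real>\<^sup>n\<close> are elements of \<open>real ^ 'n\<close>.
  Since HOL-Analysis also defines \<open>connected\<close>, graph connectivity has to be referred
  to as \<open>Digraph_Component.connected\<close>.
\<close>

definition neighbors :: "'n pair_pre_digraph \<Rightarrow> 'n \<Rightarrow> 'n set" where
  "neighbors G i = {j. (i, j) \<in> parcs G}"

definition adjacency_matrix :: "'n::finite pair_pre_digraph \<Rightarrow> real ^ 'n ^ 'n" where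
  "adjacency_matrix G = (\<chi> i j. if (i, j) \<in> parcs G then 1 else 0)"

definition kuramoto_energy :: "'n::finite pair_pre_digraph \<Rightarrow> real ^ 'n \<Rightarrow> real" where
  "kuramoto_energy G \<theta> =
     1 / 2 * (\<Sum>i\<in>UNIV. \<Sum>j\<in>UNIV. adjacency_matrix G $ i $ j * (1 - cos (\<theta> $ i - \<theta> $ j)))"

definition partial_deriv :: "'n \<Rightarrow> (real ^ 'n \<Rightarrow> real) \<Rightarrow> real ^ 'n::finite \<Rightarrow> real" where
  "partial_deriv i f x = deriv (\<lambda>t. f (x + t *\<^sub>R axis i 1)) 0"

definition gradient :: "(real ^ 'n::finite \<Rightarrow> real) \<Rightarrow> real ^ 'n \<Rightarrow> real ^ 'n" where
  "gradient f x = (\<chi> i. partial_deriv i f x)"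

definition hessian :: "(real ^ 'n::finite \<Rightarrow> real) \<Rightarrow> real ^ 'n \<Rightarrow> real ^ 'n ^ 'n" where
  "hessian f x = (\<chi> i j. partial_deriv i (partial_deriv j f) x)"

text \<open>
  Symmetry is not part of this definition: it is only applied to the Hessian of a smooth
  function, which is symmetric anyway.
\<close>

definition positive_semidefinite :: "real ^ 'n ^ 'n::finite \<Rightarrow> bool" where
  "positive_semidefinite A \<longleftrightarrow> (\<forall>x. 0 \<le> x \<bullet> (A *v x))"

definition second_order_stationary :: "(real ^ 'n::finite \<Rightarrow> real) \<Rightarrow> real ^ 'n \<Rightarrow> bool" where
  "second_order_stationary f x \<longleftrightarrow> gradient f x = 0 \<and> positive_semidefinite (hessian f x)"

definition phasor :: "real ^ 'n::finite \<Rightarrow> 'n \<Rightarrow> real ^ 2" where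
  "phasor \<theta> i = vector [cos (\<theta> $ i), sin (\<theta> $ i)]"

end

theory Submission
  imports Defs
begin

text \<open>
  Write \<open>S = S1 \<union> S2\<close>, let \<open>v\<^sub>k\<close> be the phasor of \<open>k\<close>, and let \<open>R\<close> be the sum of the phasors
  over \<open>P \<union> S\<close>. The structural hypotheses say that all nodes of \<open>S\<close> see the same \<open>R\<close>, up to
  themselves and to neighbours in \<open>Q\<close>; and the neighbours in \<open>Q\<close> are invisible to first order,
  because only nodes of \<open>S1\<close> have any and all of \<open>Q \<union> S1\<close> has the same phasor \<open>v\<close>. So the gradient equation at
  \<open>i \<in> S\<close> says that \<open>R\<close> is parallel to \<open>v\<^sub>i\<close>, which leaves only a sign to be determined.

  The sign comes from the Hessian. Its quadratic form at the indicator vector of a node set \<open>T\<close>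
  is the sum of \<open>cos (\<theta>\<^sub>i - \<theta>\<^sub>k)\<close> over the edges \<open>ik\<close> leaving \<open>T\<close>, so this cut sum is
  nonnegative (\<open>cut_sum_nonneg\<close>). For \<open>i \<in> S2\<close> take \<open>T = {i}\<close>: the neighbours of \<open>i\<close> are
  \<open>P \<union> S - {i}\<close>, so \<open>R \<bullet> v\<^sub>i - 1 \<ge> 0\<close>. For \<open>S1\<close> the cut around a single node would involve
  its neighbours in \<open>Q\<close>, so take \<open>T = Q \<union> S1\<close> instead, which no edge at \<open>Q\<close> leaves: every node of
  \<open>S1\<close> contributes \<open>R \<bullet> v - card S1\<close>, and thus \<open>R \<bullet> v \<ge> card S1 > 0\<close> if \<open>S1\<close> is nonempty.
  Hence \<open>R \<bullet> v\<^sub>i > 0\<close> for all \<open>i \<in> S\<close>, and each of these phasors is the direction \<open>sgn R\<close>.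
\<close>

lemma adjacency_matrix_commute:
  assumes "pair_graph G"
  shows "adjacency_matrix G $ i $ j = adjacency_matrix G $ j $ i"
proof -
  interpret pair_graph G by fact
  show ?thesis
    using arcs_symmetric by (auto simp: adjacency_matrix_def)
qed

lemma sum_adjacency_matrix:
  "(\<Sum>k\<in>UNIV. adjacency_matrix G $ i $ k * f k) = sum f (neighbors G i)"
  by (simp add: adjacency_matrix_def neighbors_def sum.If_cases if_distrib[of "\<lambda>x. x * _"]
      cong: if_cong)

text \<open>
  The derivatives are kept as sums over ordered pairs, in which a node enters only through the
  increment \<open>axis i 1 $ j - axis i 1 $ k\<close> of the phase difference across \<open>jk\<close>. The quadratic form
  of the Hessian then needs no case distinction between diagonal and off-diagonal entries.
\<close>

lemma partial_deriv_kuramoto_energy: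
  "partial_deriv i (kuramoto_energy G) \<theta> =
     1 / 2 * (\<Sum>j\<in>UNIV. \<Sum>k\<in>UNIV. adjacency_matrix G $ j $ k *
       (sin (\<theta> $ j - \<theta> $ k) * (axis i 1 $ j - axis i 1 $ k)))"
  unfolding partial_deriv_def kuramoto_energy_def
proof (intro DERIV_imp_deriv DERIV_cmult DERIV_sum)
  show "((\<lambda>t. 1 - cos ((\<theta> + t *\<^sub>R axis i 1) $ j - (\<theta> + t *\<^sub>R axis i 1) $ k))
      has_real_derivative sin (\<theta> $ j - \<theta> $ k) * (axis i 1 $ j - axis i 1 $ k)) (at 0)" for j k
    by (auto intro!: derivative_eq_intros)
qed

lemma hessian_kuramoto_energy:
  "hessian (kuramoto_energy G) \<theta> $ h $ i =
     1 / 2 * (\<Sum>j\<in>UNIV. \<Sum>k\<in>UNIV. adjacency_matrix G $ j $ k *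
       (cos (\<theta> $ j - \<theta> $ k) * (axis h 1 $ j - axis h 1 $ k) * (axis i 1 $ j - axis i 1 $ k)))"
  unfolding hessian_def partial_deriv_kuramoto_energy
  unfolding partial_deriv_def vec_lambda_beta
proof (intro DERIV_imp_deriv DERIV_cmult DERIV_sum)
  show "((\<lambda>t. sin ((\<theta> + t *\<^sub>R axis h 1) $ j - (\<theta> + t *\<^sub>R axis h 1) $ k)
        * (axis i 1 $ j - axis i 1 $ k))
      has_real_derivative cos (\<theta> $ j - \<theta> $ k) * (axis h 1 $ j - axis h 1 $ k)
        * (axis i 1 $ j - axis i 1 $ k)) (at 0)" for j k
    by (auto intro!: derivative_eq_intros)
qed

lemma gradient_kuramoto_energy:
  assumes "pair_graph G"
  shows "gradient (kuramoto_energy G) \<theta> $ i = (\<Sum>k\<in>neighbors G i. sin (\<theta> $ i - \<theta> $ k))"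
proof -
  let ?A = "adjacency_matrix G" and ?s = "\<lambda>j k. sin (\<theta> $ j - \<theta> $ k)"
  have "(\<Sum>j\<in>UNIV. \<Sum>k\<in>UNIV. ?A $ j $ k * (?s j k * (axis i 1 $ j - axis i 1 $ k)))
      = (\<Sum>j\<in>UNIV. (\<Sum>k\<in>UNIV. ?A $ j $ k * ?s j k) * axis i 1 $ j)
      - (\<Sum>j\<in>UNIV. \<Sum>k\<in>UNIV. ?A $ j $ k * ?s j k * axis i 1 $ k)"
    by (simp add: algebra_simps sum_subtractf sum_distrib_left)
  also have "\<dots> = (\<Sum>k\<in>UNIV. ?A $ i $ k * ?s i k) - (\<Sum>j\<in>UNIV. ?A $ j $ i * ?s j i)"
    by (simp add: axis_def if_distrib[of "\<lambda>x. _ * x"] cong: if_cong)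
  also have "(\<Sum>j\<in>UNIV. ?A $ j $ i * ?s j i) = - (\<Sum>k\<in>UNIV. ?A $ i $ k * ?s i k)"
    unfolding sum_negf[symmetric]
  proof (rule sum.cong[OF refl])
    fix j
    have "?s j i = - ?s i j"
      by (metis minus_diff_eq sin_minus)
    then show "?A $ j $ i * ?s j i = - (?A $ i $ j * ?s i j)"
      by (simp add: adjacency_matrix_commute[OF assms, of j i])
  qed
  finally show ?thesis
    by (simp add: gradient_def partial_deriv_kuramoto_energy sum_adjacency_matrix)
qed

lemma hessian_quadratic_form:
  fixes x :: "real ^ 'n::finite"
  shows "x \<bullet> (hessian (kuramoto_energy G) \<theta> *v x) =
     1 / 2 * (\<Sum>j\<in>UNIV. \<Sum>k\<in>UNIV. adjacency_matrix G $ j $ k *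
       (cos (\<theta> $ j - \<theta> $ k) * (x $ j - x $ k)\<^sup>2))"
proof -
  let ?d = "\<lambda>i j k. axis i 1 $ j - axis i (1::real) $ k"
  let ?c = "\<lambda>j k. adjacency_matrix G $ j $ k * cos (\<theta> $ j - \<theta> $ k)"
  have diff: "(\<Sum>i\<in>UNIV. x $ i * ?d i j k) = x $ j - x $ k" for j k
    by (simp add: axis_def algebra_simps sum_subtractf if_distrib[of "\<lambda>y. _ * y"] cong: if_cong)
  have rot: "(\<Sum>i\<in>UNIV. \<Sum>j\<in>UNIV. \<Sum>k\<in>UNIV. f i j k) =
      (\<Sum>j\<in>UNIV. \<Sum>k\<in>UNIV. \<Sum>i\<in>UNIV. f i j k)"
    for f :: "'n \<Rightarrow> 'n \<Rightarrow> 'n \<Rightarrow> real"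
    by (subst sum.swap) (intro sum.cong refl sum.swap)
  have "x \<bullet> (hessian (kuramoto_energy G) \<theta> *v x) =
      (\<Sum>h\<in>UNIV. \<Sum>i\<in>UNIV. \<Sum>j\<in>UNIV. \<Sum>k\<in>UNIV.
        1 / 2 * (?c j k * ((x $ h * ?d h j k) * (x $ i * ?d i j k))))"
    by (simp add: inner_vec_def matrix_vector_mult_def hessian_kuramoto_energy
        sum_distrib_left sum_distrib_right mult_ac)
  also have "\<dots> = (\<Sum>j\<in>UNIV. \<Sum>k\<in>UNIV. \<Sum>h\<in>UNIV. \<Sum>i\<in>UNIV.
        1 / 2 * (?c j k * ((x $ h * ?d h j k) * (x $ i * ?d i j k))))"
    by (rule trans[OF sum.cong[OF refl rot] rot])
  also have "\<dots> = (\<Sum>j\<in>UNIV. \<Sum>k\<in>UNIV.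
        1 / 2 * (?c j k * ((\<Sum>h\<in>UNIV. x $ h * ?d h j k) * (\<Sum>i\<in>UNIV. x $ i * ?d i j k))))"
    by (simp only: sum_product, simp only: sum_distrib_left)
  finally show ?thesis
    by (simp add: diff power2_eq_square sum_distrib_left mult_ac)
qed

text \<open>
  At the indicator vector of \<open>T\<close> the quadratic form retains exactly the edges between \<open>T\<close> and its
  complement, each of them counted in both orientations, which cancels the factor \<open>1 / 2\<close>.
\<close>

lemma cut_sum_nonneg:
  assumes "pair_graph G" "second_order_stationary (kuramoto_energy G) \<theta>"
  shows "0 \<le> (\<Sum>i\<in>T. \<Sum>k\<in>neighbors G i - T. cos (\<theta> $ i - \<theta> $ k))"
proof -
  let ?A = "adjacency_matrix G" and ?c = "\<lambda>j k. cos (\<theta> $ j - \<theta> $ k)"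
  let ?x = "\<chi> i. if i \<in> T then 1 else (0 :: real)"
  let ?f = "\<lambda>j k. if j \<in> T \<and> k \<notin> T then ?A $ j $ k * ?c j k else 0"
  have swap: "(\<Sum>j\<in>UNIV. \<Sum>k\<in>UNIV. ?f k j) = (\<Sum>j\<in>UNIV. \<Sum>k\<in>UNIV. ?f j k)"
    by (rule sum.swap)
  have sym: "?A $ j $ k * ?c j k = ?A $ k $ j * ?c k j" for j k
    by (metis adjacency_matrix_commute[OF assms(1)] cos_minus minus_diff_eq)
  have "?A $ j $ k * (?c j k * (?x $ j - ?x $ k)\<^sup>2) = ?f j k + ?f k j" for j k
    using sym[of j k] by auto
  then have "?x \<bullet> (hessian (kuramoto_energy G) \<theta> *v ?x) = (\<Sum>j\<in>UNIV. \<Sum>k\<in>UNIV. ?f j k)"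
    by (simp add: hessian_quadratic_form sum.distrib swap del: vec_lambda_beta)
  also have "\<dots> = (\<Sum>j\<in>UNIV. if j \<in> T
      then \<Sum>k\<in>UNIV. ?A $ j $ k * (if k \<in> T then 0 else ?c j k) else 0)"
    by (intro sum.cong refl) (auto intro!: sum.cong)
  also have "\<dots> = (\<Sum>j\<in>T. \<Sum>k\<in>neighbors G j - T. ?c j k)"
    by (simp add: sum_adjacency_matrix sum.If_cases Diff_eq)
  finally show ?thesis
    using assms(2) unfolding second_order_stationary_def positive_semidefinite_def by metis
qed

lemma phasor_eq_iff:
  "phasor \<theta> i = phasor \<theta> j \<longleftrightarrow> cos (\<theta> $ i) = cos (\<theta> $ j) \<and> sin (\<theta> $ i) = sin (\<theta> $ j)"
  by (simp add: phasor_def vec_eq_iff forall_2)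

lemma norm_phasor: "norm (phasor \<theta> i) = 1"
  by (simp add: phasor_def norm_vec_def L2_set_def sum_2)

text \<open>
  The sine and cosine sums are the coordinates of the resultant in the orthonormal frame formed
  by the phasor of \<open>i\<close> and its rotation by a right angle; so the two hypotheses make the
  resultant a positive multiple of that phasor.
\<close>

lemma phasor_eq_sgn_resultant:
  assumes "(\<Sum>k\<in>K. sin (\<theta> $ i - \<theta> $ k)) = 0" "0 < (\<Sum>k\<in>K. cos (\<theta> $ i - \<theta> $ k))"
  shows "phasor \<theta> i = sgn (\<Sum>k\<in>K. phasor \<theta> k)"
proof -
  define a where "a = (\<Sum>k\<in>K. cos (\<theta> $ i - \<theta> $ k))"
  define c where "c = (\<Sum>k\<in>K. cos (\<theta> $ k))"
  define s where "s = (\<Sum>k\<in>K. sin (\<theta> $ k))"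
  have a: "a = cos (\<theta> $ i) * c + sin (\<theta> $ i) * s"
    by (simp add: a_def c_def s_def cos_diff sum.distrib sum_distrib_left)
  have 0: "sin (\<theta> $ i) * c - cos (\<theta> $ i) * s = 0"
    using assms(1) by (simp add: c_def s_def sin_diff sum_subtractf sum_distrib_left)
  have "c = a * cos (\<theta> $ i)" "s = a * sin (\<theta> $ i)"
    using a 0 sin_cos_squared_add[of "\<theta> $ i"] by algebra+
  then have "(\<Sum>k\<in>K. phasor \<theta> k) = a *\<^sub>R phasor \<theta> i"
    by (simp add: vec_eq_iff forall_2 phasor_def c_def s_def)
  moreover have "0 < a"
    using assms(2) by (simp add: a_def)
  ultimately show ?thesis
    by (simp add: sgn_scaleR) (simp add: sgn_div_norm norm_phasor)
qed

theorem lemma5p9: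
  fixes G :: "'n::finite pair_pre_digraph"
    and W Q S1 S2 P :: "'n set"
    and \<theta> :: "real ^ 'n"
    and v :: "real ^ 2"
  assumes graph: "pair_graph G" "pverts G = UNIV"
    and connected: "Digraph_Component.connected (with_proj G)"
    and W_subset: "W \<subseteq> pverts G"
    and W_union: "W = Q \<union> S1 \<union> S2 \<union> P"
    and W_disjoint: "Q \<inter> S1 = {}" "Q \<inter> S2 = {}" "Q \<inter> P = {}"
      "S1 \<inter> S2 = {}" "S1 \<inter> P = {}" "S2 \<inter> P = {}"
    and neighbors_Q: "\<And>i. i \<in> Q \<Longrightarrow> neighbors G i \<subseteq> S1"
    and neighbors_S: "\<And>i. i \<in> S1 \<union> S2 \<Longrightarrow>
      neighbors G i = P \<union> {q \<in> Q. (q, i) \<in> parcs G} \<union> ((S1 \<union> S2) - {i})"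
    and stationary: "second_order_stationary (kuramoto_energy G) \<theta>"
    and unit_v: "norm v = 1"
    and sync: "\<And>i. i \<in> Q \<union> S1 \<Longrightarrow> phasor \<theta> i = v"
  shows "\<forall>i\<in>S1 \<union> S2. \<forall>j\<in>S1 \<union> S2. phasor \<theta> i = phasor \<theta> j"
proof -
  let ?K = "P \<union> S1 \<union> S2"
  \<comment> \<open>A neighbour in \<open>Q\<close> of a node in \<open>S2\<close> would have a neighbour outside \<open>S1\<close>.\<close>
  have no_Q: "{q \<in> Q. (q, i) \<in> parcs G} = {}" if "i \<in> S2" for i
    using that neighbors_Q W_disjoint(4) by (auto simp: neighbors_def)
  have same: "cos (\<theta> $ i) = cos (\<theta> $ j)" "sin (\<theta> $ i) = sin (\<theta> $ j)"
    if "i \<in> Q \<union> S1" "j \<in> Q \<union> S1" for i j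
    using sync[OF that(1)] sync[OF that(2)] phasor_eq_iff[of \<theta> i j] by auto
  have parallel: "(\<Sum>k\<in>?K. sin (\<theta> $ i - \<theta> $ k)) = 0" if i: "i \<in> S1 \<union> S2" for i
  proof -
    have "0 = (\<Sum>k\<in>neighbors G i. sin (\<theta> $ i - \<theta> $ k))"
      using stationary gradient_kuramoto_energy[OF graph(1), of \<theta> i]
      by (simp add: second_order_stationary_def)
    \<comment> \<open>The two index sets differ by neighbours in \<open>Q\<close>, which are in phase with \<open>i\<close>, and by \<open>i\<close> itself.\<close>
    also have "\<dots> = (\<Sum>k\<in>?K. sin (\<theta> $ i - \<theta> $ k))"
    proof (rule sum.mono_neutral_cong)
      show "sin (\<theta> $ i - \<theta> $ k) = 0" if "k \<in> neighbors G i - ?K" for k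
      proof -
        have "k \<in> Q" "i \<notin> S2"
          using that neighbors_S[OF i] no_Q by auto
        then show ?thesis
          using i same[of i k] by (simp add: sin_diff)
      qed
      show "sin (\<theta> $ i - \<theta> $ k) = 0" if "k \<in> ?K - neighbors G i" for k
      proof -
        have "k = i"
          using that i neighbors_S[OF i] by blast
        then show ?thesis by simp
      qed
    qed auto
    finally show ?thesis ..
  qed
  have positive: "0 < (\<Sum>k\<in>?K. cos (\<theta> $ i - \<theta> $ k))" if i: "i \<in> S1 \<union> S2" for i
  proof (cases "i \<in> S2")
    case True
    have K: "neighbors G i - {i} = ?K - {i}"
      using neighbors_S[OF i] no_Q[OF True] by auto
    have "0 \<le> (\<Sum>k\<in>?K - {i}. cos (\<theta> $ i - \<theta> $ k))"
      using cut_sum_nonneg[OF graph(1) stationary, of "{i}"] K by simp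
    also have "\<dots> = (\<Sum>k\<in>?K. cos (\<theta> $ i - \<theta> $ k)) - 1"
      using True by (subst sum_diff1) auto
    finally show ?thesis by simp
  next
    case False
    with i have i1: "i \<in> S1" by simp
    have cos_same: "cos (\<theta> $ j - \<theta> $ k) = cos (\<theta> $ i - \<theta> $ k)" if "j \<in> S1" for j k
      using same[of j i] that i1 by (simp add: cos_diff)
    have leave_Q: "neighbors G j - (Q \<union> S1) = {}" if "j \<in> Q" for j
      using neighbors_Q[OF that] by auto
    have leave_S1: "neighbors G j - (Q \<union> S1) = ?K - S1" if "j \<in> S1" for j
      using neighbors_S[of j] that W_disjoint by auto
    have "0 \<le> (\<Sum>j\<in>Q \<union> S1. \<Sum>k\<in>neighbors G j - (Q \<union> S1). cos (\<theta> $ j - \<theta> $ k))"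
      by (rule cut_sum_nonneg[OF graph(1) stationary])
    also have "\<dots> = (\<Sum>j\<in>S1. \<Sum>k\<in>?K - S1. cos (\<theta> $ i - \<theta> $ k))"
      using W_disjoint(1) by (simp add: sum.union_disjoint leave_Q leave_S1 cos_same)
    also have "\<dots> = card S1 * (\<Sum>k\<in>?K - S1. cos (\<theta> $ i - \<theta> $ k))"
      by simp
    finally have "0 \<le> (\<Sum>k\<in>?K - S1. cos (\<theta> $ i - \<theta> $ k))"
      using i1 by (simp add: zero_le_mult_iff card_gt_0_iff) auto
    also have "\<dots> = (\<Sum>k\<in>?K. cos (\<theta> $ i - \<theta> $ k)) - (\<Sum>k\<in>S1. cos (\<theta> $ i - \<theta> $ k))"
      by (rule sum_diff) auto
    also have "(\<Sum>k\<in>S1. cos (\<theta> $ i - \<theta> $ k)) = (\<Sum>k\<in>S1. 1)"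
      by (intro sum.cong refl) (simp flip: cos_same)
    finally show ?thesis
      using i1 card_gt_0_iff[of S1] by auto
  qed
  have "phasor \<theta> i = sgn (\<Sum>k\<in>?K. phasor \<theta> k)" if "i \<in> S1 \<union> S2" for i
    using phasor_eq_sgn_resultant parallel[OF that] positive[OF that] by blast
  then show ?thesis by metis
qed

end
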